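(* Let $A=[a_{i,j}]\in\mathbb{R}^{n,n}$ be symmetric, irreducible and of tree structure with respect to a given weighted rooted tree $\Gamma_{(0)}$ with weights $w_{i,j}$. Then the following are equivalent: (1) $A$ is nonsingular and $A^{-1}$ is an $M$-matrix; (2) all weights $w_{i,j}$ of $\Gamma_{(0)}$ are positive.
   Context: A weighted rooted tree $\Gamma_{(0)}$ has vertex set $\{0,1,\dots,n\}$, where $0$ is the root, and each edge $\{r,s\}$ carries a real weight $w_{r,s}=w_{s,r}$. Convention: $\Gamma_{(0)}$ is obtained from a tree $\Gamma$ with vertex set $\{1,\dots,n\}$ by adding the root $0$ and one new edge $\{0,1\}$; the vertices of $\Gamma$ are numbered by a depth-first search starting at vertex $1$. For vertices $i,j$, $P_{i,j}$ denotes the unique path (regarded as its set of edges) between $i$ and $j$ in the tree. A matrix $A=[a_{i,j}]\in\mathbb{R}^{n,n}$ is of tree structure with respect to $\Gamma_{(0)}$ if for all $i,j=1,\dots,n$ $$a_{i,j}=\sum_{\{r,s\}\in P_{i,0}\cap P_{j,0}} w_{r,s},$$ the sum being over the common edges of the paths $P_{i,0}$ and $P_{j,0}$. An $M$-matrix is a real $n\times n$ matrix of the form $tI-B$ with $B\ge 0$ entrywise and $t\ge\rho(B)$, where $\rho$ is the spectral radius. *)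

theory Defs
  imports
    "HOL-Combinatorics.Permutations"
    "Jordan_Normal_Form.Gauss_Jordan_Elimination"
    "Jordan_Normal_Form.Spectral_Radius"
begin

text \<open>
  Finite simple undirected graphs are given by a vertex set and a set of two-element edges.
  (The predicate \<open>tree\<close> of the AFP entry \<^verbatim>\<open>Graph_Theory\<close> only excludes directed cycles and is
  therefore not the notion of an undirected tree.)
\<close>

definition simple_graph :: "'a set \<Rightarrow> 'a set set \<Rightarrow> bool" where
  "simple_graph V E \<longleftrightarrow> finite V \<and> (\<forall>e\<in>E. \<exists>u\<in>V. \<exists>v\<in>V. u \<noteq> v \<and> e = {u, v})"

definition is_path :: "'a set set \<Rightarrow> 'a \<Rightarrow> 'a list \<Rightarrow> 'a \<Rightarrow> bool" where
  "is_path E u p v \<longleftrightarrow> p \<noteq> [] \<and> hd p = u \<and> last p = v \<and> distinct p \<and>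
     successively (\<lambda>x y. {x, y} \<in> E) p"

definition is_cycle :: "'a set set \<Rightarrow> 'a list \<Rightarrow> bool" where
  "is_cycle E p \<longleftrightarrow> 3 \<le> length p \<and> distinct p \<and> successively (\<lambda>x y. {x, y} \<in> E) p \<and>
     {last p, hd p} \<in> E"

definition is_tree :: "'a set \<Rightarrow> 'a set set \<Rightarrow> bool" where
  "is_tree V E \<longleftrightarrow> simple_graph V E \<and> V \<noteq> {} \<and>
     (\<forall>u\<in>V. \<forall>v\<in>V. \<exists>p. is_path E u p v) \<and> (\<nexists>p. is_cycle E p)"

definition path_edges :: "'a list \<Rightarrow> 'a set set" where
  "path_edges p = {{p ! i, p ! Suc i} | i. Suc i < length p}"

definition tree_path :: "'a set set \<Rightarrow> 'a \<Rightarrow> 'a \<Rightarrow> 'a set set" where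
  "tree_path E u v = path_edges (THE p. is_path E u p v)"

text \<open>
  \<open>dfs E s st vs\<close>: a depth-first search of the graph with edge set \<open>E\<close>, started at \<open>s\<close>, can reach
  a state with stack \<open>st\<close> (current vertex first) in which \<open>vs\<close> lists the visited vertices in the
  order of their discovery. The order in which neighbours are explored is left open.
\<close>

inductive dfs :: "'a set set \<Rightarrow> 'a \<Rightarrow> 'a list \<Rightarrow> 'a list \<Rightarrow> bool" for E s where
  start: "dfs E s [s] [s]"
| advance: "dfs E s (u # st) vs \<Longrightarrow> {u, v} \<in> E \<Longrightarrow> v \<notin> set vs \<Longrightarrow> dfs E s (v # u # st) (vs @ [v])"
| backtrack: "dfs E s (u # st) vs \<Longrightarrow> (\<And>v. {u, v} \<in> E \<Longrightarrow> v \<in> set vs) \<Longrightarrow> dfs E s st vs"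

text \<open>The completed search from vertex \<open>1\<close> discovers the vertices in the order \<open>1, \<dots>, n\<close>.\<close>

definition dfs_numbered :: "nat \<Rightarrow> nat set set \<Rightarrow> bool" where
  "dfs_numbered n E \<longleftrightarrow> dfs E 1 [] [1..<n + 1]"

definition rooted_edges :: "nat set set \<Rightarrow> nat set set" where
  "rooted_edges E = insert {0, 1} E"

text \<open>
  Weights are functions on undirected edges, so \<open>w {r, s}\<close> is automatically symmetric.
  Vertices are numbered from \<open>1\<close> but matrix entries from \<open>0\<close>: row and column \<open>i - 1\<close> belong
  to vertex \<open>i\<close>.
\<close>

definition tree_structured :: "nat \<Rightarrow> nat set set \<Rightarrow> (nat set \<Rightarrow> real) \<Rightarrow> real mat \<Rightarrow> bool" where
  "tree_structured n E w A \<longleftrightarrow> A \<in> carrier_mat n n \<and>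
     (\<forall>i\<in>{1..n}. \<forall>j\<in>{1..n}. A $$ (i - 1, j - 1) =
        (\<Sum>e \<in> tree_path (rooted_edges E) i 0 \<inter> tree_path (rooted_edges E) j 0. w e))"

text \<open>
  No simultaneous permutation of rows and columns yields a block upper triangular matrix with
  diagonal blocks of sizes \<open>k\<close> and \<open>n - k\<close>, \<open>0 < k < n\<close>. Every \<open>1 \<times> 1\<close> matrix is irreducible.
\<close>

definition irreducible_mat :: "nat \<Rightarrow> 'a::zero mat \<Rightarrow> bool" where
  "irreducible_mat n A \<longleftrightarrow> A \<in> carrier_mat n n \<and>
     \<not> (\<exists>p k. p permutes {..<n} \<and> 0 < k \<and> k < n \<and> (\<forall>i\<in>{k..<n}. \<forall>j<k. A $$ (p i, p j) = 0))"

definition M_matrix :: "nat \<Rightarrow> real mat \<Rightarrow> bool" where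
  "M_matrix n M \<longleftrightarrow> (\<exists>t B. B \<in> carrier_mat n n \<and> (\<forall>i<n. \<forall>j<n. 0 \<le> B $$ (i, j)) \<and>
     spectral_radius (map_mat complex_of_real B) \<le> t \<and> M = t \<cdot>\<^sub>m 1\<^sub>m n - B)"

end

theory Submission
  imports Defs
begin

text \<open>
  In a rooted tree every vertex other than the root owns the edge to its parent, and this
  accounts for every edge exactly once (\<open>bij_betw_parent_edge\<close>). Let \<open>L\<close> be the 0-1 matrix that
  records which edges lie on the path from a vertex to the root, and let \<open>D\<close> be the diagonal
  matrix of the weights. Counting common path edges is then the factorization \<open>A = L\<^sup>T D L\<close>
  (\<open>tree_matrix_factorization\<close>). Since the path of a vertex is the path of its parent with one more
  edge, \<open>L\<close> is inverted by the reduced incidence matrix \<open>M\<close>, whose column for a vertex has 1 at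
  that vertex and, unless its parent is the root, -1 at the parent (\<open>ancestor_incidence\<close>).
  Hence \<open>A\<close> is nonsingular iff no weight vanishes, and then its inverse is \<open>M D\<^sup>-\<^sup>1 M\<^sup>T\<close>, a weighted Laplacian of the tree with the
  root deleted and edge conductances \<open>1/w\<close>.

  If all weights are positive, this Laplacian has nonpositive off-diagonal entries and nonnegative
  row sums. Writing it as \<open>t I - B\<close> with \<open>t\<close> large, \<open>B\<close> is nonnegative with row sums at most \<open>t\<close>,
  which bounds its spectral radius (\<open>M_matrixI\<close>).

  Conversely, if the inverse is an $M$-matrix, its off-diagonal entry at a vertex and its parent is
  \<open>-1/w\<close>, so every weight is positive except perhaps the one at the root, which shows up only on
  the diagonal. Its sign is read off from the determinant: the determinant of an $M$-matrix is
  nonnegative (\<open>M_matrix_det_nonneg\<close>), while that of \<open>M D\<^sup>-\<^sup>1 M\<^sup>T\<close> is a positive multiple of the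
  product of all \<open>1/w\<close>.
\<close>

section \<open>Paths in acyclic graphs\<close>

lemma successively_edge_rev:
  "successively (\<lambda>x y. {x, y} \<in> E) (rev p) \<longleftrightarrow> successively (\<lambda>x y. {x, y} \<in> E) p"
  by (simp add: insert_commute)

lemma is_path_Cons:
  "is_path E u (u # p) v \<longleftrightarrow>
     (p = [] \<and> u = v) \<or> (p \<noteq> [] \<and> {u, hd p} \<in> E \<and> u \<notin> set p \<and> is_path E (hd p) p v)"
  unfolding is_path_def by (cases p) (auto simp: successively_Cons)

lemma is_path_suffix:
  "is_path E u (q @ x # p) v \<Longrightarrow> is_path E x (x # p) v"
  unfolding is_path_def by (auto simp: successively_append_iff)

lemma is_path_refl_unique: "is_path E v p v \<longleftrightarrow> p = [v]"
  unfolding is_path_def by (cases p) (auto split: if_splits)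

text \<open>
  Where two paths with the same ends first part, the pieces up to the next common vertex close up
  to a cycle.
\<close>

lemma acyclic_path_unique:
  assumes acyclic: "\<nexists>c. is_cycle E c"
    and "is_path E u p v" and "is_path E u q v"
  shows "p = q"
  using assms(2,3)
proof (induction p arbitrary: u q)
  case Nil
  then show ?case by (simp add: is_path_def)
next
  case (Cons u' p)
  have u': "u' = u" using Cons.prems(1) by (simp add: is_path_def)
  obtain q' where q: "q = u # q'"
    using Cons.prems(2) by (cases q) (auto simp: is_path_def)
  show ?case
  proof (cases "u = v")
    case True
    then show ?thesis using Cons.prems by (simp add: is_path_refl_unique)
  next
    case False
    from Cons.prems(1) False have p: "p \<noteq> []" "{u, hd p} \<in> E" "u \<notin> set p" "is_path E (hd p) p v"
      by (auto simp: is_path_Cons u')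
    from Cons.prems(2) False have q': "q' \<noteq> []" "{u, hd q'} \<in> E" "u \<notin> set q'"
      "is_path E (hd q') q' v" by (auto simp: is_path_Cons q)
    show ?thesis
    proof (cases "hd p = hd q'")
      case True
      then have "p = q'" using Cons.IH[OF p(4)] q'(4) by simp
      then show ?thesis by (simp add: q u')
    next
      case False
      have "v \<in> set p" "v \<in> set q'"
        using p q' last_in_set[of p] last_in_set[of q'] unfolding is_path_def by auto
      then have "\<exists>z\<in>set p. z \<in> set q'" by blast
      \<comment> \<open>\<open>z\<close> is the first vertex of \<open>p\<close> that \<open>q'\<close> also visits.\<close>
      then obtain a z b where pab: "p = a @ z # b" and z: "z \<in> set q'"
        and a: "\<forall>x\<in>set a. x \<notin> set q'"
        by (rule split_list_first_propE)
      from z obtain c d where qcd: "q' = c @ z # d" by (meson split_list)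
      let ?c = "u # a @ z # rev c"
      have ac: "a \<noteq> [] \<or> c \<noteq> []" using False by (auto simp: pab qcd)
      have suc_az: "successively (\<lambda>x y. {x, y} \<in> E) (u # a @ [z])"
      proof -
        have "successively (\<lambda>x y. {x, y} \<in> E) ((u # a @ [z]) @ b)"
          using Cons.prems(1) by (simp add: is_path_def u' pab)
        then show ?thesis unfolding successively_append_iff by blast
      qed
      have suc_cz: "successively (\<lambda>x y. {x, y} \<in> E) (z # rev c)"
      proof -
        have "successively (\<lambda>x y. {x, y} \<in> E) (c @ [z])"
          using q'(4) unfolding is_path_def qcd by (auto simp: successively_append_iff)
        then show ?thesis using successively_edge_rev[of E "c @ [z]"] by simp
      qed
      have "successively (\<lambda>x y. {x, y} \<in> E) ((u # a @ [z]) @ rev c)"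
        using suc_az suc_cz unfolding successively_append_iff[of _ "u # a @ [z]"] successively_Cons
        by auto
      moreover have "distinct ?c"
        using p q' a unfolding is_path_def pab qcd by auto
      moreover have "3 \<le> length ?c" using ac by (cases a; cases c) auto
      moreover have "{last ?c, hd ?c} \<in> E"
        using q'(2) by (cases c) (auto simp: qcd insert_commute)
      ultimately have "is_cycle E ?c" by (simp add: is_cycle_def)
      then show ?thesis using acyclic by blast
    qed
  qed
qed

lemma path_edges_Cons:
  assumes "p \<noteq> []"
  shows "path_edges (u # p) = insert {u, hd p} (path_edges p)"
proof -
  have "path_edges (u # p) =
      (\<lambda>i. {(u # p) ! i, (u # p) ! Suc i}) ` {i. Suc i < length (u # p)}"
    unfolding path_edges_def by auto
  also have "{i. Suc i < length (u # p)} = insert 0 (Suc ` {i. Suc i < length p})"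
  proof (rule Set.set_eqI)
    fix i
    show "i \<in> {i. Suc i < length (u # p)} \<longleftrightarrow> i \<in> insert 0 (Suc ` {i. Suc i < length p})"
      using assms by (cases i) auto
  qed
  also have "(\<lambda>i. {(u # p) ! i, (u # p) ! Suc i}) ` \<dots> = insert {u, hd p} (path_edges p)"
    using assms unfolding path_edges_def by (auto simp: hd_conv_nth image_image)
  finally show ?thesis .
qed

lemma path_edges_subset: "e \<in> path_edges p \<Longrightarrow> e \<subseteq> set p"
  unfolding path_edges_def by auto


section \<open>Rooted trees\<close>

text \<open>
  A tree hung at \<open>r\<close> enters only through the unique path from each vertex to the root; \<open>V\<close> are
  the remaining vertices.
\<close>

locale rooted_tree =
  fixes V :: "'a set" and F :: "'a set set" and r :: 'a
  assumes root_notin: "r \<notin> V"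
    and edge_ends: "e \<in> F \<Longrightarrow> \<exists>u\<in>insert r V. \<exists>v\<in>insert r V. u \<noteq> v \<and> e = {u, v}"
    and path_ex: "u \<in> insert r V \<Longrightarrow> \<exists>p. is_path F u p r"
    and path_unique: "is_path F u p r \<Longrightarrow> is_path F u q r \<Longrightarrow> p = q"
begin

definition root_path :: "'a \<Rightarrow> 'a list" where
  "root_path u = (THE p. is_path F u p r)"

definition parent :: "'a \<Rightarrow> 'a" where
  "parent u = hd (tl (root_path u))"

definition parent_edge :: "'a \<Rightarrow> 'a set" where
  "parent_edge u = {u, parent u}"

lemma root_path_eqI: "is_path F u p r \<Longrightarrow> root_path u = p"
  unfolding root_path_def using path_unique by blast

lemma root_path: "u \<in> insert r V \<Longrightarrow> is_path F u (root_path u) r"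
  using path_ex root_path_eqI by blast

lemma root_path_root: "root_path r = [r]"
  by (rule root_path_eqI) (simp add: is_path_refl_unique)

lemma tree_path_conv: "tree_path F u r = path_edges (root_path u)"
  by (simp add: tree_path_def root_path_def)

lemma root_path_parent:
  assumes u: "u \<in> V"
  shows "root_path u = u # root_path (parent u)"
    and "parent_edge u \<in> F" and "parent u \<in> insert r V" and "u \<notin> set (root_path (parent u))"
proof -
  have ur: "u \<noteq> r" using u root_notin by blast
  have path: "is_path F u (root_path u) r" using root_path u by blast
  then obtain p where p: "root_path u = u # p"
    by (cases "root_path u") (auto simp: is_path_def)
  with path ur have *: "p \<noteq> []" "{u, hd p} \<in> F" "u \<notin> set p" "is_path F (hd p) p r"
    by (auto simp: is_path_Cons)
  have par: "parent u = hd p" by (simp add: parent_def p)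
  have rp: "root_path (parent u) = p" using root_path_eqI[OF *(4)] by (simp add: par)
  show "root_path u = u # root_path (parent u)" by (simp add: p rp)
  show e: "parent_edge u \<in> F" using * by (simp add: parent_edge_def par)
  show "u \<notin> set (root_path (parent u))" using * by (simp add: rp)
  show "parent u \<in> insert r V" using edge_ends[OF e] by (auto simp: parent_edge_def doubleton_eq_iff)
qed

lemma parent_neq: "u \<in> V \<Longrightarrow> parent u \<noteq> u"
  by (metis doubleton_eq_iff edge_ends parent_edge_def root_path_parent(2))

lemma tree_path_root: "tree_path F r r = {}"
  by (simp add: tree_path_conv root_path_root path_edges_def)

lemma tree_path_parent:
  assumes u: "u \<in> V"
  shows "tree_path F u r = insert (parent_edge u) (tree_path F (parent u) r)"
    and "parent_edge u \<notin> tree_path F (parent u) r"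
proof -
  have "is_path F (parent u) (root_path (parent u)) r" using root_path root_path_parent(3)[OF u] .
  then have "root_path (parent u) \<noteq> []" "hd (root_path (parent u)) = parent u"
    by (auto simp: is_path_def)
  then show "tree_path F u r = insert (parent_edge u) (tree_path F (parent u) r)"
    by (simp add: tree_path_conv root_path_parent(1)[OF u] path_edges_Cons parent_edge_def)
  show "parent_edge u \<notin> tree_path F (parent u) r"
    using path_edges_subset[of "parent_edge u" "root_path (parent u)"] root_path_parent(4)[OF u]
    by (auto simp: tree_path_conv parent_edge_def)
qed

lemma no_mutual_parents:
  assumes "u \<in> V" "v \<in> V" "parent u = v"
  shows "parent v \<noteq> u"
proof
  assume "parent v = u"
  then have "length (root_path u) = Suc (Suc (length (root_path u)))"
    using root_path_parent(1)[OF assms(1)] root_path_parent(1)[OF assms(2)] assms(3) by simp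
  then show False by simp
qed

text \<open>
  An edge joins two vertices one of which lies on the root path of the other, as its second
  vertex by uniqueness of paths. So edges may be indexed by the vertices below the root.
\<close>

lemma edge_is_parent_edge:
  assumes "{u, v} \<in> F" "u \<noteq> v" "u \<in> insert r V" "v \<in> insert r V"
  shows "(u \<in> V \<and> parent u = v) \<or> (v \<in> V \<and> parent v = u)"
proof (cases "v \<in> set (root_path u)")
  case False
  have path: "is_path F u (root_path u) r" using root_path assms(3) .
  then have hd: "root_path u \<noteq> []" "hd (root_path u) = u" by (auto simp: is_path_def)
  with path False assms(1) have "is_path F v (v # root_path u) r"
    by (simp add: is_path_Cons insert_commute)
  then have "root_path v = v # root_path u" by (rule root_path_eqI)
  then have "parent v = u" by (simp add: parent_def hd)
  moreover have "v \<noteq> r"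
    using \<open>root_path v = v # root_path u\<close> hd(1) by (auto simp: root_path_root)
  ultimately show ?thesis using assms(4) by blast
next
  case True
  have path: "is_path F u (root_path u) r" using root_path assms(3) .
  then obtain p where p: "root_path u = u # p"
    by (cases "root_path u") (auto simp: is_path_def)
  with True assms(2) have "v \<in> set p" by simp
  then obtain a b where ab: "p = a @ v # b" by (meson split_list)
  have vb: "is_path F v (v # b) r"
    using is_path_suffix[of F u "u # a" v b r] path by (simp add: p ab)
  moreover have "u \<notin> set (v # b)" using path by (simp add: p ab is_path_def)
  ultimately have "is_path F u (u # v # b) r"
    using assms(1) by (subst is_path_Cons) simp
  then have rp: "root_path u = u # v # b" by (rule root_path_eqI)
  then have "parent u = v" by (simp add: parent_def)
  moreover have "u \<noteq> r" using rp by (auto simp: root_path_root)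
  ultimately show ?thesis using assms(3) by blast
qed

lemma bij_betw_parent_edge: "bij_betw parent_edge V F"
  unfolding bij_betw_def
proof
  show "inj_on parent_edge V"
    by (rule inj_onI) (metis doubleton_eq_iff no_mutual_parents parent_edge_def)
  show "parent_edge ` V = F"
  proof
    show "parent_edge ` V \<subseteq> F" using root_path_parent(2) by blast
    show "F \<subseteq> parent_edge ` V"
    proof
      fix e assume e: "e \<in> F"
      then obtain u v where uv: "u \<in> insert r V" "v \<in> insert r V" "u \<noteq> v" "e = {u, v}"
        using edge_ends by blast
      then have "(u \<in> V \<and> parent u = v) \<or> (v \<in> V \<and> parent v = u)"
        using edge_is_parent_edge e by blast
      then show "e \<in> parent_edge ` V"
        by (auto simp: uv(4) parent_edge_def insert_commute image_iff)
    qed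
  qed
qed

lemma tree_path_subset: "u \<in> insert r V \<Longrightarrow> tree_path F u r \<subseteq> F"
proof (induction "length (root_path u)" arbitrary: u rule: less_induct)
  case less
  show ?case
  proof (cases "u = r")
    case True
    then show ?thesis by (simp add: tree_path_root)
  next
    case False
    then have u: "u \<in> V" using less.prems by blast
    then have "tree_path F (parent u) r \<subseteq> F"
      using less.hyps root_path_parent(1,3)[OF u] by simp
    then show ?thesis using tree_path_parent(1)[OF u] root_path_parent(2)[OF u] by simp
  qed
qed

end

text \<open>
  The new root has only one neighbour, so a path that ends in it is a path of the old tree
  followed by the new edge.
\<close>

lemma is_path_rooted_edges:
  assumes E: "\<And>e. e \<in> E \<Longrightarrow> 0 \<notin> e" and u: "u \<noteq> 0"
  shows "is_path (rooted_edges E) u p 0 \<longleftrightarrow> (\<exists>q. p = q @ [0] \<and> is_path E u q 1)"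
proof
  assume p: "is_path (rooted_edges E) u p 0"
  then obtain q where q: "p = q @ [0]" by (cases p rule: rev_cases) (auto simp: is_path_def)
  with p u have "q \<noteq> []" by (auto simp: is_path_def)
  with p have *: "hd q = u" "distinct q" "0 \<notin> set q" "{last q, 0} \<in> rooted_edges E"
    "successively (\<lambda>x y. {x, y} \<in> rooted_edges E) q"
    by (auto simp: q is_path_def successively_append_iff)
  have "last q = 1"
    using *(4) E by (auto simp: rooted_edges_def doubleton_eq_iff)
  moreover have "successively (\<lambda>x y. {x, y} \<in> E) q"
    using *(5) by (rule successively_mono) (use *(3) in \<open>auto simp: rooted_edges_def doubleton_eq_iff\<close>)
  ultimately show "\<exists>q. p = q @ [0] \<and> is_path E u q 1"
    using q * \<open>q \<noteq> []\<close> by (auto simp: is_path_def)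
next
  assume "\<exists>q. p = q @ [0] \<and> is_path E u q 1"
  then obtain q where q: "p = q @ [0]" "is_path E u q 1" by blast
  then have suc: "successively (\<lambda>x y. {x, y} \<in> E) q" by (simp add: is_path_def)
  have "0 \<notin> set q"
  proof
    assume "0 \<in> set q"
    then obtain a b where ab: "q = a @ 0 # b" by (meson split_list)
    have "a \<noteq> []" using q(2) u ab by (auto simp: is_path_def)
    with suc have "{last a, 0} \<in> E" by (simp add: ab successively_append_iff)
    then show False using E by blast
  qed
  moreover have "successively (\<lambda>x y. {x, y} \<in> rooted_edges E) q"
    using suc by (rule successively_mono) (auto simp: rooted_edges_def)
  ultimately show "is_path (rooted_edges E) u p 0"
    using q by (auto simp: is_path_def successively_append_iff rooted_edges_def insert_commute)
qed

lemma rooted_tree_rooted_edges: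
  assumes tree: "is_tree {1..n} E"
  shows "rooted_tree {1..n} (rooted_edges E) 0"
proof
  from tree have n: "1 \<in> {1..n}" by (auto simp: is_tree_def)
  have ends: "\<exists>u\<in>{1..n}. \<exists>v\<in>{1..n}. u \<noteq> v \<and> e = {u, v}" if "e \<in> E" for e
    using tree that by (simp add: is_tree_def simple_graph_def)
  have E: "0 \<notin> e" if "e \<in> E" for e
    using ends[OF that] by auto
  show "0 \<notin> {1..n}" by simp
  show "\<exists>u\<in>insert 0 {1..n}. \<exists>v\<in>insert 0 {1..n}. u \<noteq> v \<and> e = {u, v}"
    if "e \<in> rooted_edges E" for e
  proof (cases "e = {0, 1}")
    case True
    have "\<exists>v\<in>insert 0 {1..n}. 0 \<noteq> v \<and> e = {0, v}"
      by (rule bexI[of _ 1]) (use True n in auto)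
    then show ?thesis by blast
  next
    case False
    then show ?thesis using that ends[of e] by (auto simp: rooted_edges_def)
  qed
  show "\<exists>p. is_path (rooted_edges E) u p 0" if "u \<in> insert 0 {1..n}" for u
  proof (cases "u = 0")
    case True
    then show ?thesis by (simp add: is_path_refl_unique)
  next
    case False
    then have "\<exists>q. is_path E u q 1" using tree that n by (auto simp: is_tree_def)
    then show ?thesis using is_path_rooted_edges[OF E False] by blast
  qed
  show "p = q" if paths: "is_path (rooted_edges E) u p 0" "is_path (rooted_edges E) u q 0" for u p q
  proof (cases "u = 0")
    case True
    then show ?thesis using paths by (simp add: is_path_refl_unique)
  next
    case False
    have acyclic: "\<nexists>c. is_cycle E c" using tree by (simp add: is_tree_def)
    obtain p' where p: "p = p' @ [0]" "is_path E u p' 1"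
      using paths(1) is_path_rooted_edges[OF E False] by blast
    obtain q' where q: "q = q' @ [0]" "is_path E u q' 1"
      using paths(2) is_path_rooted_edges[OF E False] by blast
    have "p' = q'" using acyclic_path_unique[OF acyclic p(2) q(2)] .
    then show ?thesis by (simp add: p q)
  qed
qed

section \<open>Nonnegative matrices and $M$-matrices\<close>

text \<open>
  In the eigenvalue equation of an eigenvalue of largest modulus, the coordinate in which the
  eigenvector is largest gives the bound.
\<close>

lemma spectral_radius_le_row_sum:
  fixes B :: "real mat"
  assumes B: "B \<in> carrier_mat n n" and n: "0 < n"
    and nonneg: "\<And>i j. i < n \<Longrightarrow> j < n \<Longrightarrow> 0 \<le> B $$ (i, j)"
    and row_sum: "\<And>i. i < n \<Longrightarrow> (\<Sum>j<n. B $$ (i, j)) \<le> t"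
  shows "spectral_radius (map_mat complex_of_real B) \<le> t"
proof -
  let ?C = "map_mat complex_of_real B"
  have C: "?C \<in> carrier_mat n n" using B by simp
  obtain ev where ev: "ev \<in> spectrum ?C" and norm_ev: "norm ev = spectral_radius ?C"
    using spectral_radius_mem_max(1)[OF C n] by auto
  then obtain v where "eigenvector ?C v ev" by (auto simp: spectrum_def eigenvalue_def)
  then have v: "v \<in> carrier_vec n" "v \<noteq> 0\<^sub>v n" "?C *\<^sub>v v = ev \<cdot>\<^sub>v v"
    using B by (auto simp: eigenvector_def)
  let ?N = "(\<lambda>i. norm (v $ i)) ` {..<n}"
  have "Max ?N \<in> ?N" using n by (intro Max_in) auto
  then obtain i where i: "i < n" "norm (v $ i) = Max ?N" by force
  then have max: "norm (v $ j) \<le> norm (v $ i)" if "j < n" for j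
    using that by (auto intro!: Max_ge)
  have pos: "0 < norm (v $ i)"
  proof (rule ccontr)
    assume "\<not> 0 < norm (v $ i)"
    then have "v $ j = 0" if "j < n" for j using max[OF that] by simp
    then have "v = 0\<^sub>v n" using v(1) by (intro eq_vecI) auto
    then show False using v(2) by blast
  qed
  have "ev * v $ i = (?C *\<^sub>v v) $ i" using v i by simp
  also have "\<dots> = (\<Sum>j<n. complex_of_real (B $$ (i, j)) * v $ j)"
    using B v(1) i(1) by (auto simp: scalar_prod_def atLeast0LessThan intro!: sum.cong)
  finally have "norm ev * norm (v $ i) = norm (\<Sum>j<n. complex_of_real (B $$ (i, j)) * v $ j)"
    by (metis norm_mult)
  also have "\<dots> \<le> (\<Sum>j<n. norm (complex_of_real (B $$ (i, j)) * v $ j))" by (rule norm_sum)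
  also have "\<dots> \<le> (\<Sum>j<n. B $$ (i, j) * norm (v $ i))"
    using nonneg i(1) max by (intro sum_mono) (auto simp: norm_mult intro!: mult_left_mono)
  also have "\<dots> = (\<Sum>j<n. B $$ (i, j)) * norm (v $ i)" by (simp add: sum_distrib_right)
  also have "\<dots> \<le> t * norm (v $ i)" using row_sum[OF i(1)] pos by (intro mult_right_mono) auto
  finally show ?thesis using pos norm_ev by simp
qed

lemma M_matrixI:
  assumes X: "X \<in> carrier_mat n n" and n: "0 < n"
    and offdiag: "\<And>i j. i < n \<Longrightarrow> j < n \<Longrightarrow> i \<noteq> j \<Longrightarrow> X $$ (i, j) \<le> 0"
    and row_sum: "\<And>i. i < n \<Longrightarrow> 0 \<le> (\<Sum>j<n. X $$ (i, j))"
  shows "M_matrix n X"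
proof -
  \<comment> \<open>Any upper bound of the diagonal would do; this sum needs no maximum.\<close>
  define t where "t = (\<Sum>i<n. \<bar>X $$ (i, i)\<bar>)"
  define B where "B = t \<cdot>\<^sub>m 1\<^sub>m n - X"
  have B: "B \<in> carrier_mat n n" using X by (auto simp: B_def)
  have entry: "B $$ (i, j) = (if i = j then t else 0) - X $$ (i, j)" if "i < n" "j < n" for i j
    using X that by (simp add: B_def)
  have diag: "X $$ (i, i) \<le> t" if "i < n" for i
  proof -
    have "\<bar>X $$ (i, i)\<bar> \<le> t" unfolding t_def using that by (intro member_le_sum) auto
    then show ?thesis by simp
  qed
  have nonneg: "0 \<le> B $$ (i, j)" if "i < n" "j < n" for i j
    using entry[OF that] diag[of i] offdiag[of i j] that by auto
  have "(\<Sum>j<n. B $$ (i, j)) \<le> t" if "i < n" for i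
  proof -
    have "(\<Sum>j<n. B $$ (i, j)) = (\<Sum>j<n. (if i = j then t else 0) - X $$ (i, j))"
      using entry that by (intro sum.cong) auto
    also have "\<dots> = t - (\<Sum>j<n. X $$ (i, j))" using that by (simp add: sum_subtractf)
    finally show ?thesis using row_sum[OF that] by simp
  qed
  then have "spectral_radius (map_mat complex_of_real B) \<le> t"
    using spectral_radius_le_row_sum[OF B n] nonneg by blast
  moreover have "X = t \<cdot>\<^sub>m 1\<^sub>m n - B" using X by (intro eq_matI) (auto simp: B_def)
  ultimately show ?thesis using B nonneg by (auto simp: M_matrix_def)
qed

lemma M_matrix_offdiag_nonpos:
  assumes "M_matrix n X" "i < n" "j < n" "i \<noteq> j"
  shows "X $$ (i, j) \<le> 0"
  using assms by (auto simp: M_matrix_def)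

text \<open>
  The determinant is the value at \<open>t\<close> of the characteristic polynomial of the nonnegative part.
  This polynomial is monic and has no real root above \<open>t\<close>, so it cannot be negative at \<open>t\<close>.
\<close>

lemma M_matrix_det_nonneg:
  assumes "M_matrix n X" and n: "0 < n"
  shows "0 \<le> det X"
proof (rule ccontr)
  assume neg: "\<not> 0 \<le> det X"
  obtain t B where B: "B \<in> carrier_mat n n"
    and radius: "spectral_radius (map_mat complex_of_real B) \<le> t" and X: "X = t \<cdot>\<^sub>m 1\<^sub>m n - B"
    using assms(1) by (auto simp: M_matrix_def)
  let ?p = "char_poly B" and ?C = "map_mat complex_of_real B"
  have C: "?C \<in> carrier_mat n n" using B by simp
  have "X = - char_matrix B t" using B by (intro eq_matI) (auto simp: X char_matrix_def)
  then have "poly ?p t < 0" using neg char_poly_matrix[OF B, of t] by simp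
  moreover have "lead_coeff ?p = 1" using degree_monic_char_poly[OF B] by simp
  then obtain c where "\<forall>x\<ge>c. 1 \<le> poly ?p x" using poly_pinfty_gt_lc[of ?p] by auto
  then have "0 < poly ?p (max c (t + 1))" using max.cobounded1[of c "t + 1"] by fastforce
  ultimately obtain x where x: "t < x" "poly ?p x = 0"
    using poly_IVT_pos[of t "max c (t + 1)" ?p] by force
  have "poly (char_poly ?C) (complex_of_real x) = complex_of_real (poly ?p x)"
    by (simp add: of_real_hom.char_poly_hom[OF B])
  then have "complex_of_real x \<in> spectrum ?C"
    using x(2) by (simp add: spectrum_def eigenvalue_root_char_poly[OF C])
  then have "norm (complex_of_real x) \<le> spectral_radius ?C"
    by (intro spectral_radius_mem_max(2)[OF C n] imageI)
  with radius x(1) show False by simp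
qed

lemma inverse_of_right_inverse:
  fixes A :: "'a::field mat"
  assumes A: "A \<in> carrier_mat n n" and X: "X \<in> carrier_mat n n" and AX: "A * X = 1\<^sub>m n"
  shows "invertible_mat A" and "the (mat_inverse A) = X"
proof -
  have XA: "X * A = 1\<^sub>m n" by (rule mat_mult_left_right_inverse[OF A X AX])
  then show "invertible_mat A"
    using A X AX unfolding invertible_mat_def inverts_mat_def by (auto intro!: exI[of _ X])
  have "A \<in> Units (ring_mat TYPE('a) n ())"
    using A X AX XA by (auto simp: Units_def ring_mat_def)
  then obtain Y where Y: "mat_inverse A = Some Y"
    using mat_inverse(1)[OF A, of "()"] by (cases "mat_inverse A") auto
  then have "Y * A = 1\<^sub>m n" "Y \<in> carrier_mat n n" using mat_inverse(2)[OF A] by auto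
  then have "Y = Y * (A * X)" by (simp add: AX)
  also have "\<dots> = (Y * A) * X" using A X \<open>Y \<in> carrier_mat n n\<close> by simp
  also have "\<dots> = X" using \<open>Y * A = 1\<^sub>m n\<close> X by simp
  finally show "the (mat_inverse A) = X" by (simp add: Y)
qed

lemma invertible_mat_det_nonzero:
  fixes A :: "'a::field mat"
  assumes A: "A \<in> carrier_mat n n" and "invertible_mat A"
  shows "det A \<noteq> 0"
proof -
  obtain B where B: "A * B = 1\<^sub>m n" "B * A = 1\<^sub>m (dim_row B)"
    using assms unfolding invertible_mat_def inverts_mat_def by auto
  have "dim_col B = n" using B(1) by (metis index_mult_mat(3) index_one_mat(3))
  moreover have "dim_row B = n" using B(2) A by (metis carrier_matD(2) index_mult_mat(3) index_one_mat(3))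
  ultimately have "B \<in> carrier_mat n n" by blast
  then have "det A * det B = 1" using det_mult[OF A] B(1) by (metis det_one)
  then show ?thesis by auto
qed


section \<open>Congruence with a diagonal matrix\<close>

definition diagonal_mat_of :: "nat \<Rightarrow> (nat \<Rightarrow> 'a::zero) \<Rightarrow> 'a mat" where
  "diagonal_mat_of n d = mat n n (\<lambda>(i, j). if i = j then d i else 0)"

lemma diagonal_mat_of_carrier [simp]: "diagonal_mat_of n d \<in> carrier_mat n n"
  by (simp add: diagonal_mat_of_def)

lemma diagonal_mat_of_mult:
  assumes "P \<in> carrier_mat n m"
  shows "diagonal_mat_of n d * P = mat n m (\<lambda>(i, j). d i * P $$ (i, j))"
  using assms
  by (intro eq_matI) (auto simp: diagonal_mat_of_def scalar_prod_def if_distrib[where f = "\<lambda>x. x * _"] cong: if_cong)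

lemma det_diagonal_mat_of: "det (diagonal_mat_of n d) = (\<Prod>k<n. d k)"
proof -
  have "det (diagonal_mat_of n d) = prod_list (diag_mat (diagonal_mat_of n d))"
    by (rule det_upper_triangular[of _ n]) (auto simp: diagonal_mat_of_def)
  also have "diag_mat (diagonal_mat_of n d) = map d [0..<n]"
    by (auto simp: diag_mat_def diagonal_mat_of_def)
  finally show ?thesis by (simp add: prod.list_conv_set_nth atLeast0LessThan)
qed

lemma congruence_entry:
  fixes P :: "'a::comm_ring_1 mat"
  assumes P: "P \<in> carrier_mat n n" and "i < n" "j < n"
  shows "(P * (diagonal_mat_of n d * transpose_mat P)) $$ (i, j) =
         (\<Sum>k<n. d k * P $$ (i, k) * P $$ (j, k))"
  using assms
  by (subst diagonal_mat_of_mult[of _ n n])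
     (auto simp: scalar_prod_def atLeast0LessThan ac_simps intro!: sum.cong)

lemma det_congruence:
  fixes P :: "'a::comm_ring_1 mat"
  assumes P: "P \<in> carrier_mat n n"
  shows "det (P * (diagonal_mat_of n d * transpose_mat P)) = (det P)\<^sup>2 * (\<Prod>k<n. d k)"
proof -
  let ?D = "diagonal_mat_of n d"
  have Pt: "transpose_mat P \<in> carrier_mat n n" using P by simp
  have "det (P * (?D * transpose_mat P)) = det P * (det ?D * det (transpose_mat P))"
    using det_mult[OF P mult_carrier_mat[OF _ Pt]] det_mult[OF _ Pt] by simp
  then show ?thesis
    using P by (simp add: det_diagonal_mat_of det_transpose power2_eq_square)
qed

lemma congruence_inverse:
  fixes L M :: "'a::field mat"
  assumes L: "L \<in> carrier_mat n n" and M: "M \<in> carrier_mat n n" and LM: "L * M = 1\<^sub>m n"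
    and d: "\<And>k. k < n \<Longrightarrow> d k \<noteq> 0"
  shows "(transpose_mat L * (diagonal_mat_of n d * L)) *
         (M * (diagonal_mat_of n (\<lambda>k. inverse (d k)) * transpose_mat M)) = 1\<^sub>m n"
    (is "(?Lt * (?D * L)) * (M * (?D' * ?Mt)) = _")
proof -
  note assoc = assoc_mult_mat[of _ n n _ n _ n]
  have Lt: "?Lt \<in> carrier_mat n n" and Mt: "?Mt \<in> carrier_mat n n" using L M by auto
  have D: "?D \<in> carrier_mat n n" and D': "?D' \<in> carrier_mat n n" by simp_all
  have DD': "?D * ?D' = 1\<^sub>m n"
    using d by (subst diagonal_mat_of_mult[of _ n n]) (auto intro!: eq_matI simp: diagonal_mat_of_def)
  have "L * (M * (?D' * ?Mt)) = (L * M) * (?D' * ?Mt)"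
    by (rule assoc[symmetric]) (use L M Mt in \<open>auto intro!: mult_carrier_mat[of _ n n]\<close>)
  also have "\<dots> = ?D' * ?Mt"
    unfolding LM by (rule left_mult_one_mat) (use Mt in \<open>auto intro!: mult_carrier_mat[of _ n n]\<close>)
  finally have 1: "L * (M * (?D' * ?Mt)) = ?D' * ?Mt" .
  have "(?Lt * (?D * L)) * (M * (?D' * ?Mt)) = ?Lt * ((?D * L) * (M * (?D' * ?Mt)))"
    by (rule assoc) (use L M Mt Lt in \<open>auto intro!: mult_carrier_mat[of _ n n]\<close>)
  also have "(?D * L) * (M * (?D' * ?Mt)) = ?D * (L * (M * (?D' * ?Mt)))"
    by (rule assoc) (use L M Mt Lt in \<open>auto intro!: mult_carrier_mat[of _ n n]\<close>)
  also have "L * (M * (?D' * ?Mt)) = ?D' * ?Mt" by (rule 1)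
  also have "?D * (?D' * ?Mt) = (?D * ?D') * ?Mt"
    by (rule assoc[symmetric]) (use Mt in \<open>auto intro!: mult_carrier_mat[of _ n n]\<close>)
  also have "\<dots> = ?Mt" using DD' Mt by simp
  also have "?Lt * ?Mt = transpose_mat (M * L)" using transpose_mult[OF M L] by simp
  also have "M * L = 1\<^sub>m n" by (rule mat_mult_left_right_inverse[OF L M LM])
  finally show ?thesis by simp
qed

section \<open>Matrices of tree structure\<close>

text \<open>
  Row and column \<open>i\<close> belong to vertex \<open>Suc i\<close>, and \<open>i\<close> also indexes the edge from this vertex to
  its parent.
\<close>

locale numbered_rooted_tree = rooted_tree "{1..n}" F 0 for n :: nat and F :: "nat set set"
begin

definition ancestor_mat :: "real mat" where
  "ancestor_mat = mat n n
     (\<lambda>(k, i). if parent_edge (Suc k) \<in> tree_path F (Suc i) 0 then 1 else 0)"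

text \<open>
  The incidence matrix of the tree, with every edge directed towards the root and the row of the
  root deleted.
\<close>

definition incidence :: "nat \<Rightarrow> nat \<Rightarrow> real" where
  "incidence i k = (if i = k then 1 else 0) - (if parent (Suc k) = Suc i then 1 else 0)"

definition incidence_mat :: "real mat" where
  "incidence_mat = mat n n (\<lambda>(i, k). incidence i k)"

definition inverse_form :: "(nat set \<Rightarrow> real) \<Rightarrow> real mat" where
  "inverse_form w = incidence_mat *
     (diagonal_mat_of n (\<lambda>k. inverse (w (parent_edge (Suc k)))) * transpose_mat incidence_mat)"

lemma ancestor_mat_carrier [simp]: "ancestor_mat \<in> carrier_mat n n"
  by (simp add: ancestor_mat_def)

lemma incidence_mat_carrier [simp]: "incidence_mat \<in> carrier_mat n n"
  by (simp add: incidence_mat_def)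

lemma inverse_form_carrier [simp]: "inverse_form w \<in> carrier_mat n n"
  unfolding inverse_form_def by (intro mult_carrier_mat[of _ n n]) auto

text \<open>
  Summation against a column of the incidence matrix takes the difference of a function along an
  edge, the value at the root being counted as zero.
\<close>

lemma sum_incidence:
  fixes f :: "nat \<Rightarrow> real"
  assumes k: "k < n"
  shows "(\<Sum>i<n. f i * incidence i k) =
         f k - (if parent (Suc k) = 0 then 0 else f (parent (Suc k) - 1))"
proof -
  have par: "parent (Suc k) \<le> n" using root_path_parent(3)[of "Suc k"] k by auto
  have "(\<Sum>i<n. f i * incidence i k) =
      (\<Sum>i<n. if i = k then f i else 0) - (\<Sum>i<n. if parent (Suc k) = Suc i then f i else 0)"
    unfolding sum_subtractf[symmetric] by (intro sum.cong) (auto simp: incidence_def)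
  also have "(\<Sum>i<n. if i = k then f i else 0) = f k" using k by simp
  also have "(\<Sum>i<n. if parent (Suc k) = Suc i then f i else 0) =
      (if parent (Suc k) = 0 then 0 else f (parent (Suc k) - 1))"
    using par by (cases "parent (Suc k)") auto
  finally show ?thesis .
qed

lemma parent_edge_eq_iff:
  "i < n \<Longrightarrow> k < n \<Longrightarrow> parent_edge (Suc k) = parent_edge (Suc i) \<longleftrightarrow> k = i"
  using bij_betw_imp_inj_on[OF bij_betw_parent_edge] by (auto simp: inj_on_eq_iff)

text \<open>
  The path of a vertex and the path of its parent differ in exactly one edge, so the difference of
  their indicator vectors is a unit vector.
\<close>

lemma ancestor_incidence: "ancestor_mat * incidence_mat = 1\<^sub>m n"
proof (rule eq_matI)
  fix k i assume "k < dim_row (1\<^sub>m n :: real mat)" "i < dim_col (1\<^sub>m n :: real mat)"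
  then have k: "k < n" and i: "i < n" by simp_all
  let ?on = "\<lambda>v. if parent_edge (Suc k) \<in> tree_path F v 0 then 1 else (0::real)"
  have "(ancestor_mat * incidence_mat) $$ (k, i) = (\<Sum>j<n. ?on (Suc j) * incidence j i)"
    using k i by (auto simp: ancestor_mat_def incidence_mat_def scalar_prod_def atLeast0LessThan
      intro!: sum.cong)
  also have "\<dots> = ?on (Suc i) - (if parent (Suc i) = 0 then 0 else ?on (Suc (parent (Suc i) - 1)))"
    by (rule sum_incidence[OF i])
  also have "\<dots> = ?on (Suc i) - ?on (parent (Suc i))"
    by (cases "parent (Suc i)") (simp_all add: tree_path_root)
  also have "\<dots> = (if k = i then 1 else 0)"
    using tree_path_parent[of "Suc i"] parent_edge_eq_iff[OF i k] i by auto
  finally show "(ancestor_mat * incidence_mat) $$ (k, i) = 1\<^sub>m n $$ (k, i)" using k i by simp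
qed (simp_all add: ancestor_mat_def incidence_mat_def)

lemma det_incidence_nonzero: "det incidence_mat \<noteq> 0"
  using det_mult[of ancestor_mat n incidence_mat] ancestor_incidence by auto

lemma sum_common_path_edges:
  fixes w :: "nat set \<Rightarrow> real"
  assumes "u \<in> insert 0 {1..n}"
  shows "(\<Sum>e\<in>tree_path F u 0 \<inter> tree_path F v 0. w e) =
    (\<Sum>k<n. w (parent_edge (Suc k)) *
       (if parent_edge (Suc k) \<in> tree_path F u 0 then 1 else 0) *
       (if parent_edge (Suc k) \<in> tree_path F v 0 then 1 else 0))"
proof -
  let ?g = "\<lambda>e. w e * (if e \<in> tree_path F u 0 then 1 else 0) *
                      (if e \<in> tree_path F v 0 then 1 else 0)"
  have fin: "finite F" using bij_betw_finite[OF bij_betw_parent_edge] by simp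
  have "(\<Sum>e\<in>tree_path F u 0 \<inter> tree_path F v 0. w e) = (\<Sum>e\<in>F. ?g e)"
    using tree_path_subset[OF assms] fin by (intro sum.mono_neutral_cong_left) auto
  also have "\<dots> = (\<Sum>u\<in>{1..n}. ?g (parent_edge u))"
    by (rule sum.reindex_bij_betw[OF bij_betw_parent_edge, symmetric])
  also have "\<dots> = (\<Sum>k<n. ?g (parent_edge (Suc k)))"
    by (rule sum.reindex_bij_witness[of _ Suc "\<lambda>u. u - 1"]) auto
  finally show ?thesis .
qed

lemma tree_matrix_factorization:
  assumes A: "A \<in> carrier_mat n n"
    and entries: "\<forall>i\<in>{1..n}. \<forall>j\<in>{1..n}.
      A $$ (i - 1, j - 1) = (\<Sum>e\<in>tree_path F i 0 \<inter> tree_path F j 0. w e)"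
  shows "A = transpose_mat ancestor_mat *
    (diagonal_mat_of n (\<lambda>k. w (parent_edge (Suc k))) * ancestor_mat)" (is "A = ?R")
proof (rule eq_matI)
  fix i j assume "i < dim_row ?R" "j < dim_col ?R"
  then have i: "i < n" and j: "j < n" by (simp_all add: ancestor_mat_def)
  have "A $$ (i, j) = (\<Sum>e\<in>tree_path F (Suc i) 0 \<inter> tree_path F (Suc j) 0. w e)"
    using entries[rule_format, of "Suc i" "Suc j"] i j by simp
  also have "\<dots> = ?R $$ (i, j)"
    using congruence_entry[of "transpose_mat ancestor_mat" n i j] i j
    by (subst sum_common_path_edges) (auto simp: ancestor_mat_def intro!: sum.cong)
  finally show "A $$ (i, j) = ?R $$ (i, j)" .
qed (use A in \<open>auto simp: ancestor_mat_def\<close>)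

lemma inverse_form_entry:
  assumes "i < n" "j < n"
  shows "inverse_form w $$ (i, j) =
    (\<Sum>k<n. inverse (w (parent_edge (Suc k))) * incidence i k * incidence j k)"
  unfolding inverse_form_def congruence_entry[OF incidence_mat_carrier assms]
  using assms by (intro sum.cong) (auto simp: incidence_mat_def)

text \<open>
  An edge meets two different vertices with opposite signs, if it meets both.
\<close>

lemma incidence_mult_nonpos:
  assumes "i < n" "j < n" "k < n" "i \<noteq> j"
  shows "incidence i k * incidence j k \<le> 0"
  using assms parent_neq[of "Suc k"] by (auto simp: incidence_def)

lemma inverse_form_offdiag_nonpos:
  assumes pos: "\<And>k. k < n \<Longrightarrow> 0 < w (parent_edge (Suc k))"
    and "i < n" "j < n" "i \<noteq> j"
  shows "inverse_form w $$ (i, j) \<le> 0"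
  unfolding inverse_form_entry[OF assms(2,3)]
proof (rule sum_nonpos)
  fix k assume "k \<in> {..<n}"
  then have "incidence i k * incidence j k \<le> 0" "0 < w (parent_edge (Suc k))"
    using incidence_mult_nonpos assms by auto
  then show "inverse (w (parent_edge (Suc k))) * incidence i k * incidence j k \<le> 0"
    by (simp add: mult.assoc mult_nonneg_nonpos)
qed

text \<open>
  A column of the incidence matrix sums to zero unless its edge ends in the deleted root; in that
  case its only entry is 1. Hence only the edges at the root contribute to the row sums.
\<close>

lemma inverse_form_row_sum_nonneg:
  assumes pos: "\<And>k. k < n \<Longrightarrow> 0 < w (parent_edge (Suc k))" and i: "i < n"
  shows "0 \<le> (\<Sum>j<n. inverse_form w $$ (i, j))"
proof -
  have "(\<Sum>j<n. inverse_form w $$ (i, j)) =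
      (\<Sum>j<n. \<Sum>k<n. inverse (w (parent_edge (Suc k))) * incidence i k * incidence j k)"
    using i by (intro sum.cong) (auto simp: inverse_form_entry)
  also have "\<dots> = (\<Sum>k<n. \<Sum>j<n. inverse (w (parent_edge (Suc k))) * incidence i k * incidence j k)"
    by (rule sum.swap)
  also have "\<dots> \<ge> 0"
  proof (rule sum_nonneg)
    fix k assume "k \<in> {..<n}"
    then have k: "k < n" by simp
    have "(\<Sum>j<n. inverse (w (parent_edge (Suc k))) * incidence i k * incidence j k) =
        inverse (w (parent_edge (Suc k))) * incidence i k * (\<Sum>j<n. incidence j k)"
      by (simp add: sum_distrib_left)
    also have "(\<Sum>j<n. incidence j k) = (if parent (Suc k) = 0 then 1 else 0)"
      using sum_incidence[OF k, of "\<lambda>_. 1"] by simp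
    finally show "0 \<le> (\<Sum>j<n. inverse (w (parent_edge (Suc k))) * incidence i k * incidence j k)"
      using pos[OF k] by (simp add: incidence_def)
  qed
  finally show ?thesis .
qed

text \<open>
  The edge between a vertex and its parent is the only edge that meets both.
\<close>

lemma inverse_form_parent_entry:
  assumes i: "i < n" and j: "j < n" and par: "parent (Suc j) = Suc i"
  shows "inverse_form w $$ (i, j) = - inverse (w (parent_edge (Suc j)))"
proof -
  have ij: "i \<noteq> j" using parent_neq[of "Suc j"] j par by auto
  have prod: "incidence i k * incidence j k = (if k = j then -1 else 0)" if "k < n" for k
    using that i j ij par parent_neq[of "Suc k"] no_mutual_parents[of "Suc j" "Suc i"]
    by (auto simp: incidence_def)
  have "inverse_form w $$ (i, j) =
      (\<Sum>k<n. if k = j then - inverse (w (parent_edge (Suc k))) else 0)"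
    unfolding inverse_form_entry[OF i j] by (intro sum.cong) (auto simp: mult.assoc prod)
  then show ?thesis using j by simp
qed

lemma det_inverse_form:
  "det (inverse_form w) = (det incidence_mat)\<^sup>2 * (\<Prod>k<n. inverse (w (parent_edge (Suc k))))"
  unfolding inverse_form_def by (rule det_congruence) simp

text \<open>
  Off-diagonal entries see every weight except those of edges at the root. When \<open>r\<close> is the only
  child of the root, one sign is left over, and the sign of the determinant determines it.
\<close>

lemma inverse_form_M_matrix_iff:
  assumes nonzero: "\<And>k. k < n \<Longrightarrow> w (parent_edge (Suc k)) \<noteq> 0"
    and root_child: "r < n" "\<And>k. k < n \<Longrightarrow> parent (Suc k) = 0 \<Longrightarrow> k = r"
  shows "M_matrix n (inverse_form w) \<longleftrightarrow> (\<forall>k<n. 0 < w (parent_edge (Suc k)))"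
proof
  assume "\<forall>k<n. 0 < w (parent_edge (Suc k))"
  then show "M_matrix n (inverse_form w)"
    using root_child(1) inverse_form_offdiag_nonpos inverse_form_row_sum_nonneg
    by (intro M_matrixI) auto
next
  assume M: "M_matrix n (inverse_form w)"
  let ?d = "\<lambda>k. inverse (w (parent_edge (Suc k)))"
  have other: "0 < ?d k" if k: "k < n" "k \<noteq> r" for k
  proof -
    obtain i where i: "parent (Suc k) = Suc i" using root_child(2)[of k] k by (cases "parent (Suc k)") auto
    then have i_n: "i < n" using root_path_parent(3)[of "Suc k"] k by auto
    have "i \<noteq> k" using parent_neq[of "Suc k"] i k by auto
    then have "- ?d k \<le> 0"
      using M_matrix_offdiag_nonpos[OF M i_n k(1)] inverse_form_parent_entry[OF i_n k(1) i] by simp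
    then show ?thesis using nonzero[OF k(1)] by simp
  qed
  have "0 \<le> (\<Prod>k<n. ?d k)"
    using M_matrix_det_nonneg[OF M] root_child(1) det_incidence_nonzero
    by (simp add: det_inverse_form zero_le_mult_iff)
  also have "(\<Prod>k<n. ?d k) = ?d r * (\<Prod>k\<in>{..<n} - {r}. ?d k)"
    using root_child(1) by (intro prod.remove) auto
  finally have "0 \<le> ?d r * (\<Prod>k\<in>{..<n} - {r}. ?d k)" .
  moreover have "0 < (\<Prod>k\<in>{..<n} - {r}. ?d k)" using other by (intro prod_pos) auto
  ultimately have "0 \<le> ?d r" by (simp add: zero_le_mult_iff)
  then have "0 < ?d r" using nonzero[OF root_child(1)] by (simp add: less_le)
  then show "\<forall>k<n. 0 < w (parent_edge (Suc k))" using other by (metis inverse_positive_iff_positive)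
qed

end

section \<open>Inverse $M$-matrices of tree structure\<close>

theorem theorem3p1:
  fixes n :: nat and E :: "nat set set" and w :: "nat set \<Rightarrow> real" and A :: "real mat"
  assumes "is_tree {1..n} E"
    and "dfs_numbered n E"
    and "A \<in> carrier_mat n n"
    and "transpose_mat A = A"
    and "irreducible_mat n A"
    and "tree_structured n E w A"
  shows "invertible_mat A \<and> M_matrix n (the (mat_inverse A)) \<longleftrightarrow>
         (\<forall>e \<in> rooted_edges E. 0 < w e)"
proof -
  let ?F = "rooted_edges E"
  interpret numbered_rooted_tree n ?F
    by (rule numbered_rooted_tree.intro) (rule rooted_tree_rooted_edges[OF assms(1)])
  let ?d = "\<lambda>k. w (parent_edge (Suc k))"
  have n: "0 < n" using assms(1) by (simp add: is_tree_def)
  have A: "A = transpose_mat ancestor_mat * (diagonal_mat_of n ?d * ancestor_mat)"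
    by (rule tree_matrix_factorization[of A w])
       (use assms(3,6) in \<open>auto simp: tree_structured_def\<close>)
  have inverse: "invertible_mat A \<and> the (mat_inverse A) = inverse_form w"
    if "\<And>k. k < n \<Longrightarrow> ?d k \<noteq> 0"
  proof -
    have "A * inverse_form w = 1\<^sub>m n"
      unfolding A inverse_form_def
      by (rule congruence_inverse) (use ancestor_incidence that in auto)
    then show ?thesis using inverse_of_right_inverse[OF assms(3) inverse_form_carrier] by blast
  qed
  have nonzero: "?d k \<noteq> 0" if "invertible_mat A" "k < n" for k
  proof -
    have "det A = (det (transpose_mat ancestor_mat))\<^sup>2 * (\<Prod>k<n. ?d k)"
      using det_congruence[of "transpose_mat ancestor_mat" n ?d] by (simp add: A)
    then have "(\<Prod>k<n. ?d k) \<noteq> 0" using invertible_mat_det_nonzero[OF assms(3) that(1)] by auto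
    then show ?thesis using that(2) by auto
  qed
  \<comment> \<open>The added edge is the only one at the root, so vertex 1 is the only child of the root.\<close>
  have root_child: "k = 0" if "k < n" "parent (Suc k) = 0" for k
  proof -
    have "{Suc k, 0} \<in> ?F" using root_path_parent(2)[of "Suc k"] that by (simp add: parent_edge_def)
    moreover have "\<forall>e\<in>E. 0 \<notin> e" using assms(1) by (fastforce simp: is_tree_def simple_graph_def)
    ultimately show ?thesis by (auto simp: rooted_edges_def doubleton_eq_iff)
  qed
  have "(\<forall>e\<in>parent_edge ` Suc ` {..<n}. 0 < w e) \<longleftrightarrow> (\<forall>k<n. 0 < ?d k)" by auto
  then have weights: "(\<forall>e\<in>?F. 0 < w e) \<longleftrightarrow> (\<forall>k<n. 0 < ?d k)"
    by (simp only: image_Suc_lessThan bij_betw_imp_surj_on[OF bij_betw_parent_edge])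
  show ?thesis unfolding weights
  proof
    assume *: "invertible_mat A \<and> M_matrix n (the (mat_inverse A))"
    then have "M_matrix n (inverse_form w)" using inverse nonzero by auto
    then show "\<forall>k<n. 0 < ?d k" using inverse_form_M_matrix_iff[of w 0] nonzero * n root_child by blast
  next
    assume *: "\<forall>k<n. 0 < ?d k"
    then have nz: "?d k \<noteq> 0" if "k < n" for k using that by force
    then have "M_matrix n (inverse_form w)"
      using inverse_form_M_matrix_iff[of w 0] * n root_child by blast
    then show "invertible_mat A \<and> M_matrix n (the (mat_inverse A))" using inverse nz by simp
  qed
qed

end
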